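(* Let $f:\omega\to\omega$ be a permutation, let $p\in(0,1)$, and let $F=f^*:2^\omega\to 2^\omega$, $F(X)(n)=X(f(n))$. If $B\in 2^\omega$ is $f$-$\mu_p$-random and $A=F(B)$ or $A=F^{-1}(B)$, then $A$ is $f$-$\mu_p$-random.
   Context: $\mu_p$ is the Bernoulli product measure on $2^\omega$: the bits $X(0),X(1),\dots$ are independent and $\mu_p(\{X: X(n)=1\})=p$ for each $n$. An $f$-$\mu_p$-Martin-Löf test is a sequence $(U_n)_n$ of open subsets of $2^\omega$, uniformly $\Sigma^0_1$ relative to the oracle $f$, with $\mu_p(U_n)\le 2^{-n}$; $X$ is $f$-$\mu_p$-random if $X\notin\bigcap_n U_n$ for every such test. *)

theory Defs
  imports "HOL-Probability.Probability" "HOL-Library.Nat_Bijection"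
begin

section \<open>Partial recursive functions relative to an oracle\<close>

text \<open>Kleene's \<open>\<mu>\<close>-recursive schemes with an additional basic function for the oracle.
  Schemes carry no arity; the arity is that of the argument list.\<close>

datatype recf =
    Zero
  | Succ
  | Proj nat
  | Oracle
  | Comp recf "recf list"
  | PrimRec recf recf
  | Mu recf

text \<open>\<open>computes f e xs y\<close>: with oracle \<open>f\<close>, the scheme \<open>e\<close> converges on the arguments \<open>xs\<close>
  with value \<open>y\<close>. In rule \<open>mu\<close> all earlier values have to converge, and be nonzero.\<close>

inductive computes :: "(nat \<Rightarrow> nat) \<Rightarrow> recf \<Rightarrow> nat list \<Rightarrow> nat \<Rightarrow> bool"
  for f :: "nat \<Rightarrow> nat" where
  zero: "computes f Zero xs 0"
| succ: "computes f Succ [x] (Suc x)"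
| proj: "i < length xs \<Longrightarrow> computes f (Proj i) xs (xs ! i)"
| query: "computes f Oracle [x] (f x)"
| comp: "length ys = length gs \<Longrightarrow> (\<forall>i<length gs. computes f (gs ! i) xs (ys ! i)) \<Longrightarrow>
    computes f h ys z \<Longrightarrow> computes f (Comp h gs) xs z"
| primrec_0: "computes f g xs y \<Longrightarrow> computes f (PrimRec g h) (0 # xs) y"
| primrec_Suc: "computes f (PrimRec g h) (n # xs) r \<Longrightarrow> computes f h (n # r # xs) y \<Longrightarrow>
    computes f (PrimRec g h) (Suc n # xs) y"
| mu: "computes f g (n # xs) 0 \<Longrightarrow> (\<forall>m<n. \<exists>y. computes f g (m # xs) (Suc y)) \<Longrightarrow>
    computes f (Mu g) xs n"

lemma computes_deterministic:
  "computes f e xs y \<Longrightarrow> computes f e xs y' \<Longrightarrow> y = y'"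
proof (induction arbitrary: y' rule: computes.induct)
  case (comp ys gs xs h z)
  from comp.prems obtain ys' where ys': "length ys' = length gs"
      "\<forall>i<length gs. computes f (gs ! i) xs (ys' ! i)" "computes f h ys' y'"
    by (cases rule: computes.cases) auto
  have "ys = ys'"
    using comp.hyps comp.IH ys' by (intro nth_equalityI) auto
  then show ?case using comp.IH ys' by blast
next
  case (primrec_Suc g h n xs r y)
  from primrec_Suc.prems obtain r' where "computes f (PrimRec g h) (n # xs) r'"
      "computes f h (n # r' # xs) y'"
    by (cases rule: computes.cases) auto
  then show ?case using primrec_Suc.IH by blast
next
  case (mu g n xs)
  from mu.prems have n': "computes f g (y' # xs) 0"
      "\<forall>m<y'. \<exists>y. computes f g (m # xs) (Suc y)"
    by (cases rule: computes.cases; auto)+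
  show ?case
  proof (rule linorder_cases[of n y'])
    assume "n < y'"
    with n' obtain y where "computes f g (n # xs) (Suc y)" by blast
    with mu.IH show ?thesis by auto
  next
    assume "y' < n"
    with mu.IH n' show ?thesis by blast
  qed simp
qed (erule computes.cases; simp)+

text \<open>A \<open>k\<close>-ary relation is computable in \<open>f\<close> if its characteristic function is.\<close>

definition computable_rel :: "(nat \<Rightarrow> nat) \<Rightarrow> nat \<Rightarrow> (nat list \<Rightarrow> bool) \<Rightarrow> bool" where
  "computable_rel f k R \<longleftrightarrow>
     (\<exists>e. \<forall>xs. length xs = k \<longrightarrow> computes f e xs (of_bool (R xs)))"


section \<open>Effectively open subsets of Cantor space\<close>

text \<open>Points of \<open>2\<^sup>\<omega>\<close> have type \<open>nat \<Rightarrow> bool\<close>, finite binary strings have type \<open>bool list\<close>.\<close>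

definition cylinder :: "bool list \<Rightarrow> (nat \<Rightarrow> bool) set" where
  "cylinder \<sigma> = {X. \<forall>i<length \<sigma>. X i = \<sigma> ! i}"

definition string_code :: "bool list \<Rightarrow> nat" where
  "string_code \<sigma> = list_encode (map of_bool \<sigma>)"

text \<open>\<open>U\<close> is generated by a set of pairs \<open>(n, \<sigma>)\<close> that is \<open>\<Sigma>\<^sup>0\<^sub>1\<close> relative to \<open>f\<close>, i.e. of the
  form \<open>\<exists>s. R(n, \<sigma>, s)\<close> with \<open>R\<close> computable in \<open>f\<close>.\<close>

definition uniformly_Sigma01 :: "(nat \<Rightarrow> nat) \<Rightarrow> (nat \<Rightarrow> (nat \<Rightarrow> bool) set) \<Rightarrow> bool" where
  "uniformly_Sigma01 f U \<longleftrightarrow>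
     (\<exists>R. computable_rel f 3 R \<and>
          (\<forall>n. U n = (\<Union>\<sigma>\<in>{\<sigma>. \<exists>s. R [n, string_code \<sigma>, s]}. cylinder \<sigma>)))"

definition bernoulli_measure :: "real \<Rightarrow> (nat \<Rightarrow> bool) measure" where
  "bernoulli_measure p = PiM UNIV (\<lambda>_. measure_pmf (bernoulli_pmf p))"

lemma open_cylinder: "open (cylinder \<sigma>)"
proof -
  have [simp]: "open {b}" for b :: bool
  proof -
    have "{True} = {False<..}" "{False} = {..<True}" by auto
    then show ?thesis by (cases b) simp_all
  qed
  have "cylinder \<sigma> = PiE UNIV (\<lambda>i. if i < length \<sigma> then {\<sigma> ! i} else UNIV)"
    by (auto simp: cylinder_def PiE_def Pi_def extensional_def split: if_splits)
  moreover have "finite {i. (if i < length \<sigma> then {\<sigma> ! i} else (UNIV :: bool set)) \<noteq> UNIV}"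
    by (rule finite_subset[of _ "{..<length \<sigma>}"]) auto
  ultimately show ?thesis
    by (simp only:) (rule open_PiE, auto)
qed

lemma uniformly_Sigma01_open: "uniformly_Sigma01 f U \<Longrightarrow> open (U n)"
  by (auto simp: uniformly_Sigma01_def intro!: open_UN open_cylinder)

lemma sets_cylinder: "cylinder \<sigma> \<in> sets (bernoulli_measure p)"
proof -
  have "cylinder \<sigma> = prod_emb UNIV (\<lambda>_. measure_pmf (bernoulli_pmf p)) {..<length \<sigma>}
      (PiE {..<length \<sigma>} (\<lambda>i. {\<sigma> ! i}))"
    by (auto simp: cylinder_def prod_emb_def PiE_def Pi_def)
  then show ?thesis
    unfolding bernoulli_measure_def by (simp add: sets_PiM_I)
qed

text \<open>Hence the values \<open>measure (bernoulli_measure p) (U n)\<close> below are genuine, not the default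
  value for nonmeasurable sets.\<close>

lemma uniformly_Sigma01_sets:
  "uniformly_Sigma01 f U \<Longrightarrow> U n \<in> sets (bernoulli_measure p)"
  by (auto simp: uniformly_Sigma01_def intro!: sets.countable_UN'' sets_cylinder)

lemma measure_bernoulli_bit:
  assumes "0 \<le> p" "p \<le> 1"
  shows "measure (bernoulli_measure p) {X. X n} = p"
proof -
  interpret product_prob_space "\<lambda>_::nat. measure_pmf (bernoulli_pmf p)" UNIV
    by (simp add: product_prob_spaceI measure_pmf.prob_space_axioms)
  have "measure (bernoulli_measure p) {X. X n} =
      measure (distr (bernoulli_measure p) (measure_pmf (bernoulli_pmf p)) (\<lambda>X. X n)) {True}"
    by (subst measure_distr) (auto simp: bernoulli_measure_def space_PiM vimage_def)
  also have "\<dots> = p"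
    using assms by (simp add: bernoulli_measure_def PiM_component measure_pmf_single)
  finally show ?thesis .
qed


section \<open>Randomness\<close>

definition martin_loef_test :: "(nat \<Rightarrow> nat) \<Rightarrow> real \<Rightarrow> (nat \<Rightarrow> (nat \<Rightarrow> bool) set) \<Rightarrow> bool" where
  "martin_loef_test f p U \<longleftrightarrow>
     uniformly_Sigma01 f U \<and> (\<forall>n. measure (bernoulli_measure p) (U n) \<le> 1 / 2 ^ n)"

definition martin_loef_random :: "(nat \<Rightarrow> nat) \<Rightarrow> real \<Rightarrow> (nat \<Rightarrow> bool) \<Rightarrow> bool" where
  "martin_loef_random f p X \<longleftrightarrow> (\<forall>U. martin_loef_test f p U \<longrightarrow> X \<notin> (\<Inter>n. U n))"

definition pullback :: "(nat \<Rightarrow> nat) \<Rightarrow> (nat \<Rightarrow> bool) \<Rightarrow> nat \<Rightarrow> bool" where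
  "pullback f X = (\<lambda>n. X (f n))"

lemma bij_pullback: "bij f \<Longrightarrow> bij (pullback f)"
  by (rule bij_betw_byWitness[where f' = "pullback (inv f)"])
     (auto simp: pullback_def bij_is_inj bij_is_surj surj_f_inv_f)

end

theory Submission
  imports Defs
begin

text \<open>Both \<open>f\<close> and its inverse are injective and computable in \<open>f\<close>. For any such \<open>g\<close> the map
  \<open>pullback g\<close> preserves the Bernoulli measure, and preimages under it of sets that are \<open>\<Sigma>\<^sup>0\<^sub>1\<close>
  relative to \<open>f\<close> are again \<open>\<Sigma>\<^sup>0\<^sub>1\<close> relative to \<open>f\<close>. So the preimage of a test capturing
  \<open>pullback g B\<close> is a test capturing \<open>B\<close>.\<close>

section \<open>Closure properties of the functions computable in an oracle\<close>

definition computable_fun :: "(nat \<Rightarrow> nat) \<Rightarrow> nat \<Rightarrow> (nat list \<Rightarrow> nat) \<Rightarrow> bool" where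
  "computable_fun f k h \<longleftrightarrow> (\<exists>e. \<forall>xs. length xs = k \<longrightarrow> computes f e xs (h xs))"

lemma computable_rel_iff_fun: "computable_rel f k R \<longleftrightarrow> computable_fun f k (\<lambda>xs. of_bool (R xs))"
  by (simp add: computable_rel_def computable_fun_def)

lemma computable_fun_cong:
  assumes "computable_fun f k h" and "\<And>xs. length xs = k \<Longrightarrow> h xs = h' xs"
  shows "computable_fun f k h'"
  using assms unfolding computable_fun_def by metis

lemma computable_fun_nth: "i < k \<Longrightarrow> computable_fun f k (\<lambda>xs. xs ! i)"
  unfolding computable_fun_def by (blast intro: computes.proj)

lemma computable_fun_comp:
  assumes "computable_fun f (length gs) h" and "\<And>g. g \<in> set gs \<Longrightarrow> computable_fun f k g"
  shows "computable_fun f k (\<lambda>xs. h (map (\<lambda>g. g xs) gs))"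
proof -
  obtain e where e: "\<And>ys. length ys = length gs \<Longrightarrow> computes f e ys (h ys)"
    using assms(1) unfolding computable_fun_def by blast
  have "\<forall>g\<in>set gs. \<exists>e. \<forall>xs. length xs = k \<longrightarrow> computes f e xs (g xs)"
    using assms(2) unfolding computable_fun_def by blast
  then obtain d where d: "\<And>g xs. g \<in> set gs \<Longrightarrow> length xs = k \<Longrightarrow> computes f (d g) xs (g xs)"
    by metis
  have "computes f (Comp e (map d gs)) xs (h (map (\<lambda>g. g xs) gs))" if "length xs = k" for xs
    by (rule computes.comp[where ys = "map (\<lambda>g. g xs) gs"]) (auto simp: that d e)
  then show ?thesis unfolding computable_fun_def by blast
qed

text \<open>In this shape composition can be chained by \<open>intro\<close>, and a claim at arity
  \<open>k\<close> is reduced to one at arity 1.\<close>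

lemma computable_fun_comp1:
  assumes "computable_fun f 1 (\<lambda>xs. h (xs ! 0))" and "computable_fun f k a"
  shows "computable_fun f k (\<lambda>xs. h (a xs))"
  using computable_fun_comp[of f "[a]" "\<lambda>xs. h (xs ! 0)" k] assms by simp

lemma computable_fun_comp2:
  assumes "computable_fun f 2 (\<lambda>xs. h (xs ! 0) (xs ! 1))"
    and "computable_fun f k a" and "computable_fun f k b"
  shows "computable_fun f k (\<lambda>xs. h (a xs) (b xs))"
  using computable_fun_comp[of f "[a, b]" "\<lambda>xs. h (xs ! 0) (xs ! 1)" k] assms
  by (auto simp: numeral_2_eq_2)

lemma computable_fun_comp3:
  assumes "computable_fun f 3 h"
    and "computable_fun f k a" and "computable_fun f k b" and "computable_fun f k c"
  shows "computable_fun f k (\<lambda>xs. h [a xs, b xs, c xs])"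
  using computable_fun_comp[of f "[a, b, c]" h k] assms by (auto simp: numeral_3_eq_3)

lemma computable_fun_Suc:
  assumes "computable_fun f k a"
  shows "computable_fun f k (\<lambda>xs. Suc (a xs))"
proof (rule computable_fun_comp1[OF _ assms])
  have "computes f Succ xs (Suc (xs ! 0))" if "length xs = 1" for xs
    using that computes.succ[of f "xs ! 0"] by (cases xs) auto
  then show "computable_fun f 1 (\<lambda>xs. Suc (xs ! 0))"
    unfolding computable_fun_def by blast
qed

lemma computable_fun_oracle:
  assumes "computable_fun f k a"
  shows "computable_fun f k (\<lambda>xs. f (a xs))"
proof (rule computable_fun_comp1[OF _ assms])
  have "computes f Oracle xs (f (xs ! 0))" if "length xs = 1" for xs
    using that computes.query[of f "xs ! 0"] by (cases xs) auto
  then show "computable_fun f 1 (\<lambda>xs. f (xs ! 0))"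
    unfolding computable_fun_def by blast
qed

lemma computable_fun_const: "computable_fun f k (\<lambda>_. c)"
proof (induction c)
  case 0
  then show ?case unfolding computable_fun_def by (blast intro: computes.zero)
qed (rule computable_fun_Suc)

text \<open>\<open>PrimRec\<close> recurses on the first argument and hands \<open>h\<close> the
  counter, the previous value and the parameters. Composing it with \<open>n\<close> followed by the
  \<open>k\<close> projections makes the recursion run for \<open>n xs\<close> steps with
  \<open>xs\<close> as parameters.\<close>

lemma computable_fun_rec_nat:
  assumes g: "computable_fun f k g" and h: "computable_fun f (k + 2) h"
    and n: "computable_fun f k n"
  shows "computable_fun f k (\<lambda>xs. rec_nat (g xs) (\<lambda>m r. h (m # r # xs)) (n xs))"
proof -
  obtain d where d: "\<And>xs. length xs = k \<Longrightarrow> computes f d xs (g xs)"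
    using g unfolding computable_fun_def by blast
  obtain e where e: "\<And>xs. length xs = k + 2 \<Longrightarrow> computes f e xs (h xs)"
    using h unfolding computable_fun_def by blast
  have rec: "computes f (PrimRec d e) (m # xs) (rec_nat (g xs) (\<lambda>m r. h (m # r # xs)) m)"
    if "length xs = k" for m xs
    by (induction m) (auto intro!: computes.primrec_0 computes.primrec_Suc d e simp: that)
  let ?H = "\<lambda>ys. rec_nat (g (tl ys)) (\<lambda>m r. h (m # r # tl ys)) (hd ys)"
  let ?gs = "n # map (\<lambda>i xs. xs ! i) [0..<k]"
  have "computes f (PrimRec d e) ys (?H ys)" if "length ys = Suc k" for ys
    using that rec by (cases ys) auto
  then have "computable_fun f (length ?gs) ?H"
    unfolding computable_fun_def by auto
  moreover have "computable_fun f k a" if "a \<in> set ?gs" for a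
    using that n by (auto intro: computable_fun_nth)
  ultimately have "computable_fun f k (\<lambda>xs. ?H (map (\<lambda>a. a xs) ?gs))"
    by (rule computable_fun_comp)
  then show ?thesis
    by (rule computable_fun_cong) (auto simp: comp_def map_nth)
qed

text \<open>Rule \<open>mu\<close> asks that all values before the first zero converge and be
  nonzero: totality of \<open>g\<close> gives the first, minimality of \<open>LEAST\<close> the
  second. A zero exists by \<open>ex\<close>, so the search is total.\<close>

lemma computable_fun_Least:
  assumes g: "computable_fun f (Suc k) g"
    and ex: "\<And>xs. length xs = k \<Longrightarrow> \<exists>n. g (n # xs) = 0"
  shows "computable_fun f k (\<lambda>xs. LEAST n. g (n # xs) = 0)"
proof -
  obtain e where e: "\<And>xs. length xs = Suc k \<Longrightarrow> computes f e xs (g xs)"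
    using g unfolding computable_fun_def by blast
  have "computes f (Mu e) xs (LEAST n. g (n # xs) = 0)" if len: "length xs = k" for xs
  proof (rule computes.mu)
    have "g ((LEAST n. g (n # xs) = 0) # xs) = 0"
      using ex[OF len] by (rule LeastI_ex)
    then show "computes f e ((LEAST n. g (n # xs) = 0) # xs) 0"
      using e[of "(LEAST n. g (n # xs) = 0) # xs"] len by simp
    show "\<forall>m<LEAST n. g (n # xs) = 0. \<exists>y. computes f e (m # xs) (Suc y)"
    proof (intro allI impI)
      fix m assume "m < (LEAST n. g (n # xs) = 0)"
      then have "g (m # xs) \<noteq> 0" by (rule not_less_Least)
      then obtain y where "g (m # xs) = Suc y" using not0_implies_Suc by blast
      then show "\<exists>y. computes f e (m # xs) (Suc y)"
        using e[of "m # xs"] len by auto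
    qed
  qed
  then show ?thesis unfolding computable_fun_def by blast
qed

section \<open>Arithmetic and the pairing function\<close>

lemma computable_fun_add:
  assumes "computable_fun f k a" and "computable_fun f k b"
  shows "computable_fun f k (\<lambda>xs. a xs + b xs)"
proof -
  have "computable_fun f k (\<lambda>xs. rec_nat (a xs) (\<lambda>m r. Suc ((m # r # xs) ! 1)) (b xs))"
    by (intro computable_fun_rec_nat computable_fun_Suc computable_fun_nth assms) simp
  moreover have "rec_nat x (\<lambda>m r. Suc r) y = x + y" for x y :: nat
    by (induction y) auto
  ultimately show ?thesis by simp
qed

lemma computable_fun_pred:
  assumes "computable_fun f k a"
  shows "computable_fun f k (\<lambda>xs. a xs - 1)"
proof -
  have "computable_fun f k (\<lambda>xs. rec_nat 0 (\<lambda>m r. (m # r # xs) ! 0) (a xs))"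
    by (intro computable_fun_rec_nat computable_fun_const computable_fun_nth assms) simp
  moreover have "rec_nat 0 (\<lambda>m r. m) x = x - 1" for x :: nat
    by (cases x) auto
  ultimately show ?thesis by simp
qed

lemma computable_fun_diff:
  assumes "computable_fun f k a" and "computable_fun f k b"
  shows "computable_fun f k (\<lambda>xs. a xs - b xs)"
proof -
  have "computable_fun f k (\<lambda>xs. rec_nat (a xs) (\<lambda>m r. (m # r # xs) ! 1 - 1) (b xs))"
    by (intro computable_fun_rec_nat computable_fun_pred computable_fun_nth assms) simp
  moreover have "rec_nat x (\<lambda>m r. r - 1) y = x - y" for x y :: nat
    by (induction y) auto
  ultimately show ?thesis by simp
qed

lemma computable_fun_triangle:
  assumes "computable_fun f k a"
  shows "computable_fun f k (\<lambda>xs. triangle (a xs))"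
proof -
  have "computable_fun f k
      (\<lambda>xs. rec_nat 0 (\<lambda>m r. (m # r # xs) ! 1 + Suc ((m # r # xs) ! 0)) (a xs))"
    by (intro computable_fun_rec_nat computable_fun_add computable_fun_Suc computable_fun_const
        computable_fun_nth assms) simp_all
  moreover have "rec_nat 0 (\<lambda>m r. r + Suc m) x = triangle x" for x
    by (induction x) auto
  ultimately show ?thesis by simp
qed

lemma computable_fun_prod_encode:
  assumes "computable_fun f k a" and "computable_fun f k b"
  shows "computable_fun f k (\<lambda>xs. prod_encode (a xs, b xs))"
  unfolding prod_encode_def using assms
  by (simp add: computable_fun_add computable_fun_triangle)

text \<open>The number \<open>x\<close> codes a pair with sum \<open>k\<close> iff
  \<open>triangle k \<le> x < triangle (Suc k)\<close>, so the sum is found by unbounded search.\<close>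

lemma prod_decode_Least:
  assumes "w = (LEAST k. Suc x - triangle (Suc k) = 0)"
  shows "prod_decode x = (x - triangle w, w - (x - triangle w))"
proof -
  obtain a b where ab: "prod_decode x = (a, b)" by fastforce
  then have "x = prod_encode (a, b)"
    by (metis prod_decode_inverse)
  then have x: "x = triangle (a + b) + a"
    by (simp add: prod_encode_def)
  have mono: "triangle i \<le> triangle j" if "i \<le> j" for i j
    using that by (induction rule: dec_induct) auto
  \<comment> \<open>Truncated subtraction writes \<open>x < triangle (Suc k)\<close> as an equation
    with 0. Taking the least such \<open>k\<close> accounts for the lower bound
    \<open>triangle k \<le> x\<close>.\<close>
  have "w = a + b"
    unfolding assms
  proof (rule Least_equality)
    show "Suc x - triangle (Suc (a + b)) = 0" using x by simp
    show "a + b \<le> k" if "Suc x - triangle (Suc k) = 0" for k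
    proof (rule ccontr)
      assume "\<not> a + b \<le> k"
      then have "triangle (Suc k) \<le> triangle (a + b)" by (intro mono) simp
      then show False using that x by simp
    qed
  qed
  then show ?thesis using ab x by simp
qed

lemma computable_fun_prod_decode:
  assumes "computable_fun f k a"
  shows "computable_fun f k (\<lambda>xs. fst (prod_decode (a xs)))"
    and "computable_fun f k (\<lambda>xs. snd (prod_decode (a xs)))"
proof -
  \<comment> \<open>The search for the sum succeeds at the latest at \<open>x\<close> itself,
    because \<open>Suc x \<le> triangle (Suc x)\<close>.\<close>
  have "x \<le> triangle x" for x by (induction x) auto
  then have "\<exists>k. Suc x - triangle (Suc k) = 0" for x
    by (intro exI[of _ x]) (metis diff_is_0_eq)
  then have "computable_fun f 1
      (\<lambda>xs. LEAST k. Suc ((k # xs) ! 1) - triangle (Suc ((k # xs) ! 0)) = 0)"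
    by (intro computable_fun_Least[where g = "\<lambda>xs. Suc (xs ! 1) - triangle (Suc (xs ! 0))"]
        computable_fun_diff computable_fun_triangle computable_fun_Suc computable_fun_nth) auto
  then have w: "computable_fun f 1 (\<lambda>xs. LEAST k. Suc (xs ! 0) - triangle (Suc k) = 0)"
    by simp
  have "computable_fun f 1 (\<lambda>xs. fst (prod_decode (xs ! 0)))"
    using computable_fun_diff[OF computable_fun_nth[of 0 1 f] computable_fun_triangle[OF w]]
    by (simp add: prod_decode_Least[OF refl])
  then show "computable_fun f k (\<lambda>xs. fst (prod_decode (a xs)))"
    by (rule computable_fun_comp1[OF _ assms])
  have "computable_fun f 1 (\<lambda>xs. snd (prod_decode (xs ! 0)))"
    using computable_fun_diff[OF w
        computable_fun_diff[OF computable_fun_nth[of 0 1 f] computable_fun_triangle[OF w]]]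
    by (simp add: prod_decode_Least[OF refl])
  then show "computable_fun f k (\<lambda>xs. snd (prod_decode (a xs)))"
    by (rule computable_fun_comp1[OF _ assms])
qed

section \<open>Operations on codes of lists\<close>

text \<open>A nonempty list has code \<open>Suc (prod_encode (head, code of tail))\<close>, so each
  round strips one entry. The empty list is stable: \<open>0 - 1 = 0\<close> decodes to
  \<open>(0, 0)\<close>, hence dropping beyond the end yields 0.\<close>

definition code_drop :: "nat \<Rightarrow> nat \<Rightarrow> nat" where
  "code_drop c i = rec_nat c (\<lambda>_ r. snd (prod_decode (r - 1))) i"

definition code_nth :: "nat \<Rightarrow> nat \<Rightarrow> nat" where
  "code_nth c i = fst (prod_decode (code_drop c i - 1))"

lemma code_drop_list_encode: "code_drop (list_encode xs) i = list_encode (drop i xs)"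
proof (induction i)
  case (Suc i)
  have "snd (prod_decode (list_encode ys - 1)) = list_encode (tl ys)" for ys
  proof (cases ys)
    case Nil
    have "prod_decode 0 = (0, 0)"
      using prod_encode_inverse[of "(0, 0)"] by (simp add: prod_encode_def)
    then show ?thesis using Nil by simp
  qed simp
  then show ?case using Suc by (simp add: code_drop_def drop_Suc tl_drop)
qed (simp add: code_drop_def)

lemma list_encode_eq_0_iff: "list_encode xs = 0 \<longleftrightarrow> xs = []"
  by (cases xs) auto

lemma code_nth_list_encode: "i < length xs \<Longrightarrow> code_nth (list_encode xs) i = xs ! i"
  by (simp add: code_nth_def code_drop_list_encode Cons_nth_drop_Suc[symmetric])

lemma computable_fun_code_drop:
  assumes "computable_fun f k a" and "computable_fun f k b"
  shows "computable_fun f k (\<lambda>xs. code_drop (a xs) (b xs))"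
proof -
  have "computable_fun f k
      (\<lambda>xs. rec_nat (a xs) (\<lambda>m r. snd (prod_decode ((m # r # xs) ! 1 - 1))) (b xs))"
    by (intro computable_fun_rec_nat computable_fun_prod_decode computable_fun_pred
        computable_fun_nth assms) simp
  then show ?thesis by (simp add: code_drop_def)
qed

lemma computable_fun_code_nth:
  assumes "computable_fun f k a" and "computable_fun f k b"
  shows "computable_fun f k (\<lambda>xs. code_nth (a xs) (b xs))"
  unfolding code_nth_def
  by (intro computable_fun_prod_decode computable_fun_pred computable_fun_code_drop assms)

text \<open>A coded list grows only at its front, so the entries are produced from the last to the
  first; this is the reason for the index \<open>m - Suc j\<close>.\<close>

definition code_select :: "(nat \<Rightarrow> nat) \<Rightarrow> nat \<Rightarrow> nat \<Rightarrow> nat" where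
  "code_select g c m = rec_nat 0 (\<lambda>j r. Suc (prod_encode (code_nth c (g (m - Suc j)), r))) m"

lemma code_select_eq: "code_select g c m = list_encode (map (\<lambda>i. code_nth c (g i)) [0..<m])"
proof -
  \<comment> \<open>Invariant of the recursion: after \<open>j\<close> rounds the code holds the
    last \<open>j\<close> of the \<open>m\<close> entries.\<close>
  have "rec_nat 0 (\<lambda>j r. Suc (prod_encode (code_nth c (g (m - Suc j)), r))) j =
      list_encode (map (\<lambda>i. code_nth c (g i)) [m - j..<m])" if "j \<le> m" for j
    using that
  proof (induction j)
    case (Suc j)
    have "[m - Suc j..<m] = (m - Suc j) # [m - j..<m]"
      using Suc.prems by (simp add: upt_conv_Cons Suc_diff_Suc)
    then show ?case using Suc by simp
  qed simp
  from this[of m] show ?thesis by (simp add: code_select_def)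
qed

text \<open>Computability of \<open>g\<close> is assumed as closure under composition at every
  arity. In this form it serves as an \<open>intro\<close> rule, and the lemmas for the oracle and
  for its inverse supply it directly.\<close>

lemma computable_fun_code_select:
  assumes g: "\<And>k a. computable_fun f k a \<Longrightarrow> computable_fun f k (\<lambda>xs. g (a xs))"
    and "computable_fun f k a" and "computable_fun f k b"
  shows "computable_fun f k (\<lambda>xs. code_select g (a xs) (b xs))"
proof (rule computable_fun_comp2[where h = "code_select g", OF _ assms(2,3)])
  \<comment> \<open>Positions in \<open>j # r # xs\<close>: 0 is the counter, 1 the accumulator, 2
    the code and 3 the length \<open>m\<close>.\<close>
  have "computable_fun f 2 (\<lambda>xs. rec_nat 0 (\<lambda>j r. Suc (prod_encode
      (code_nth ((j # r # xs) ! 2) (g ((j # r # xs) ! 3 - Suc ((j # r # xs) ! 0))),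
       (j # r # xs) ! 1))) (xs ! 1))"
    by (intro computable_fun_rec_nat computable_fun_const computable_fun_Suc
        computable_fun_prod_encode computable_fun_code_nth g computable_fun_diff
        computable_fun_nth) simp_all
  then show "computable_fun f 2 (\<lambda>xs. code_select g (xs ! 0) (xs ! 1))"
    by (simp add: code_select_def numeral_3_eq_3 numeral_2_eq_2)
qed

text \<open>Counts the \<open>j < m\<close> for which \<open>g j\<close> lies beyond the end of the
  coded list, since exactly then \<open>code_drop\<close> returns 0. The guard matters because
  \<open>code_nth\<close> returns 0 there, which would pass for a bit \<open>False\<close>.\<close>

definition select_excess :: "(nat \<Rightarrow> nat) \<Rightarrow> nat \<Rightarrow> nat \<Rightarrow> nat" where
  "select_excess g c m = rec_nat 0 (\<lambda>j r. r + (1 - code_drop c (g j))) m"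

lemma select_excess_eq_0_iff:
  "select_excess g (list_encode xs) m = 0 \<longleftrightarrow> (\<forall>i<m. g i < length xs)"
proof (induction m)
  case (Suc m)
  have "select_excess g (list_encode xs) (Suc m) = 0 \<longleftrightarrow>
      select_excess g (list_encode xs) m = 0 \<and> list_encode (drop (g m) xs) \<noteq> 0"
    by (auto simp: select_excess_def code_drop_list_encode)
  then show ?case using Suc by (auto simp: list_encode_eq_0_iff less_Suc_eq)
qed (simp add: select_excess_def)

lemma computable_fun_select_excess:
  assumes g: "\<And>k a. computable_fun f k a \<Longrightarrow> computable_fun f k (\<lambda>xs. g (a xs))"
    and "computable_fun f k a" and "computable_fun f k b"
  shows "computable_fun f k (\<lambda>xs. select_excess g (a xs) (b xs))"
proof (rule computable_fun_comp2[where h = "select_excess g", OF _ assms(2,3)])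
  have "computable_fun f 2 (\<lambda>xs. rec_nat 0 (\<lambda>j r. (j # r # xs) ! 1 +
      (1 - code_drop ((j # r # xs) ! 2) (g ((j # r # xs) ! 0)))) (xs ! 1))"
    by (intro computable_fun_rec_nat computable_fun_const computable_fun_add
        computable_fun_diff computable_fun_code_drop g computable_fun_nth) simp_all
  then show "computable_fun f 2 (\<lambda>xs. select_excess g (xs ! 0) (xs ! 1))"
    by (simp add: select_excess_def numeral_2_eq_2)
qed

lemma code_select_string_code:
  assumes "\<forall>i<m. g i < length \<tau>"
  shows "code_select g (string_code \<tau>) m = string_code (map (\<lambda>i. \<tau> ! g i) [0..<m])"
  using assms by (auto simp: code_select_eq string_code_def code_nth_list_encode comp_def
      intro!: arg_cong[where f = list_encode])

section \<open>Preimages of effectively open sets\<close>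

text \<open>A string \<open>\<tau>\<close> is enumerated into the preimage of \<open>U n\<close> once it is long enough to
  determine the first \<open>m\<close> bits of \<open>pullback g X\<close> for all \<open>X\<close> extending \<open>\<tau>\<close>, and these bits
  form a string enumerated into \<open>U n\<close>; the witness codes \<open>m\<close> and the old witness.\<close>

lemma uniformly_Sigma01_vimage_pullback:
  assumes g: "\<And>k a. computable_fun f k a \<Longrightarrow> computable_fun f k (\<lambda>xs. g (a xs))"
    and U: "uniformly_Sigma01 f U"
  shows "uniformly_Sigma01 f (\<lambda>n. pullback g -` U n)"
proof -
  obtain R where R: "computable_rel f 3 R"
    and U_eq: "\<And>n. U n = (\<Union>\<sigma>\<in>{\<sigma>. \<exists>s. R [n, string_code \<sigma>, s]}. cylinder \<sigma>)"
    using U unfolding uniformly_Sigma01_def by blast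
  define R' where "R' = (\<lambda>xs. select_excess g (xs ! 1) (fst (prod_decode (xs ! 2))) = 0 \<and>
    R [xs ! 0, code_select g (xs ! 1) (fst (prod_decode (xs ! 2))), snd (prod_decode (xs ! 2))])"
  \<comment> \<open>Conjunction by truncated subtraction: a value of \<open>of_bool\<close> is at
    most 1, so it survives exactly when the excess is 0.\<close>
  have "computable_fun f 3 (\<lambda>xs.
      of_bool (R [xs ! 0, code_select g (xs ! 1) (fst (prod_decode (xs ! 2))),
        snd (prod_decode (xs ! 2))]) - select_excess g (xs ! 1) (fst (prod_decode (xs ! 2))))"
    by (intro computable_fun_diff computable_fun_comp3[OF R[unfolded computable_rel_iff_fun]]
        computable_fun_code_select computable_fun_select_excess computable_fun_prod_decode g
        computable_fun_nth) simp_all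
  then have "computable_rel f 3 R'"
    unfolding computable_rel_iff_fun
    by (rule computable_fun_cong) (auto simp: R'_def)
  moreover have "pullback g -` U n = (\<Union>\<tau>\<in>{\<tau>. \<exists>s. R' [n, string_code \<tau>, s]}. cylinder \<tau>)" for n
  proof (intro set_eqI iffI)
    fix X assume "X \<in> pullback g -` U n"
    then obtain \<sigma> s where s: "R [n, string_code \<sigma>, s]" and X: "pullback g X \<in> cylinder \<sigma>"
      by (auto simp: U_eq)
    \<comment> \<open>Only finitely many bits of \<open>X\<close> are read, so an initial segment of
      some length \<open>N\<close> contains them all.\<close>
    obtain N where N: "\<forall>i<length \<sigma>. g i < N"
      using finite_nat_set_iff_bounded[of "g ` {..<length \<sigma>}"] by auto
    define \<tau> where "\<tau> = map X [0..<N]"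
    have len: "\<forall>i<length \<sigma>. g i < length \<tau>" using N by (simp add: \<tau>_def)
    have "map (\<lambda>i. \<tau> ! g i) [0..<length \<sigma>] = \<sigma>"
      using X N by (intro nth_equalityI) (auto simp: \<tau>_def cylinder_def pullback_def)
    then have "R' [n, string_code \<tau>, prod_encode (length \<sigma>, s)]"
      using s len code_select_string_code[OF len]
      by (simp add: R'_def numeral_2_eq_2 string_code_def select_excess_eq_0_iff)
    moreover have "X \<in> cylinder \<tau>" by (simp add: \<tau>_def cylinder_def)
    ultimately show "X \<in> (\<Union>\<tau>\<in>{\<tau>. \<exists>s. R' [n, string_code \<tau>, s]}. cylinder \<tau>)" by blast
  next
    fix X assume "X \<in> (\<Union>\<tau>\<in>{\<tau>. \<exists>s. R' [n, string_code \<tau>, s]}. cylinder \<tau>)"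
    then obtain \<tau> s where s: "R' [n, string_code \<tau>, s]" and X: "X \<in> cylinder \<tau>" by blast
    define m where "m = fst (prod_decode s)"
    define \<sigma> where "\<sigma> = map (\<lambda>i. \<tau> ! g i) [0..<m]"
    have len: "\<forall>i<m. g i < length \<tau>"
      using s by (simp add: R'_def numeral_2_eq_2 m_def string_code_def select_excess_eq_0_iff)
    have "R [n, string_code \<sigma>, snd (prod_decode s)]"
      using s code_select_string_code[OF len]
      by (simp add: R'_def numeral_2_eq_2 m_def \<sigma>_def)
    moreover have "pullback g X \<in> cylinder \<sigma>"
      using X len by (auto simp: \<sigma>_def cylinder_def pullback_def)
    ultimately show "X \<in> pullback g -` U n" by (auto simp: U_eq)
  qed
  ultimately show ?thesis unfolding uniformly_Sigma01_def by blast
qed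

section \<open>Invariance of the Bernoulli measure and of randomness\<close>

text \<open>By injectivity of \<open>g\<close> the coordinates \<open>X (g n)\<close> are distinct,
  hence again independent bits with the same law. \<open>distr_PiM_reindex\<close> gives this for
  the image measure, which measurability of \<open>pullback g\<close> turns into a statement on
  preimages.\<close>

lemma measure_vimage_pullback:
  assumes "inj g" and "S \<in> sets (bernoulli_measure p)"
  shows "measure (bernoulli_measure p) (pullback g -` S) = measure (bernoulli_measure p) S"
proof -
  let ?M = "\<lambda>_::nat. measure_pmf (bernoulli_pmf p)"
  have distr: "distr (PiM UNIV ?M) (PiM UNIV ?M) (pullback g) = PiM UNIV ?M"
    using distr_PiM_reindex[of UNIV ?M g UNIV] assms(1)
    by (simp add: pullback_def[abs_def] restrict_def measure_pmf.prob_space_axioms)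
  have "pullback g \<in> measurable (PiM UNIV ?M) (PiM UNIV ?M)"
    unfolding pullback_def by (rule measurable_PiM_single') auto
  then have "measure (distr (PiM UNIV ?M) (PiM UNIV ?M) (pullback g)) S =
      measure (PiM UNIV ?M) (pullback g -` S)"
    using assms(2) by (subst measure_distr) (auto simp: bernoulli_measure_def space_PiM)
  then show ?thesis by (simp add: distr bernoulli_measure_def)
qed

lemma martin_loef_random_pullback:
  assumes g: "\<And>k a. computable_fun f k a \<Longrightarrow> computable_fun f k (\<lambda>xs. g (a xs))"
    and "inj g" and B: "martin_loef_random f p B"
  shows "martin_loef_random f p (pullback g B)"
  unfolding martin_loef_random_def
proof (intro allI impI)
  fix U assume "martin_loef_test f p U"
  then have "martin_loef_test f p (\<lambda>n. pullback g -` U n)"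
    using uniformly_Sigma01_vimage_pullback[OF g]
    by (auto simp: martin_loef_test_def uniformly_Sigma01_sets measure_vimage_pullback[OF \<open>inj g\<close>])
  then show "pullback g B \<notin> (\<Inter>n. U n)"
    using B by (auto simp: martin_loef_random_def)
qed

text \<open>The inverse is found by searching for \<open>n\<close> with \<open>f n = x\<close>:
  surjectivity makes the search stop, and injectivity makes its result the only solution.\<close>

lemma computable_fun_inv_oracle:
  assumes "bij f" and "computable_fun f k a"
  shows "computable_fun f k (\<lambda>xs. inv f (a xs))"
proof (rule computable_fun_comp1[OF _ assms(2)])
  \<comment> \<open>The two truncated differences add up to the distance of \<open>f n\<close> and
    \<open>x\<close>, which vanishes iff they agree; the candidate \<open>n\<close> is at position 0
    and \<open>x\<close> at position 1.\<close>
  let ?g = "\<lambda>xs. (f (xs ! 0) - xs ! 1) + (xs ! 1 - f (xs ! 0))"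
  have iff: "?g (n # xs) = 0 \<longleftrightarrow> n = inv f (xs ! 0)" for n xs
  proof -
    have "?g (n # xs) = 0 \<longleftrightarrow> f n = xs ! 0" by auto
    also have "\<dots> \<longleftrightarrow> n = inv f (xs ! 0)"
      by (rule bij_inv_eq_iff[OF assms(1), symmetric])
    finally show ?thesis .
  qed
  have "computable_fun f (Suc 1) ?g"
    by (intro computable_fun_add computable_fun_diff computable_fun_oracle computable_fun_nth)
      simp_all
  then have "computable_fun f 1 (\<lambda>xs. LEAST n. ?g (n # xs) = 0)"
    by (rule computable_fun_Least) (use iff in blast)
  then show "computable_fun f 1 (\<lambda>xs. inv f (xs ! 0))"
    by (rule computable_fun_cong) (simp only: iff, rule Least_equality, simp_all)
qed

theorem theorem3p1:
  fixes f :: "nat \<Rightarrow> nat" and p :: real and A B :: "nat \<Rightarrow> bool"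
  assumes "bij f"
    and "0 < p" and "p < 1"
    and "martin_loef_random f p B"
    and "A = pullback f B \<or> A = inv (pullback f) B"
  shows "martin_loef_random f p A"
proof -
  \<comment> \<open>Both alternatives for \<open>A\<close> thus become pullbacks of
    \<open>B\<close>, along \<open>f\<close> or along \<open>inv f\<close>.\<close>
  have "inv (pullback f) B = pullback (inv f) B"
    using assms(1) by (intro inv_f_eq bij_is_inj[OF bij_pullback])
      (auto simp: pullback_def bij_is_inj)
  moreover have "martin_loef_random f p (pullback f B)"
    using assms by (intro martin_loef_random_pullback computable_fun_oracle) (auto simp: bij_is_inj)
  moreover have "martin_loef_random f p (pullback (inv f) B)"
    using assms by (intro martin_loef_random_pullback computable_fun_inv_oracle)
      (auto simp: bij_is_inj bij_imp_bij_inv)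
  ultimately show ?thesis using assms(5) by auto
qed

end
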